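(* Let $(\mathfrak{X},d)$ be a totally bounded metric space (nonempty) and let $\delta,\sigma,\iota,\alpha:\ell^\infty(\mathfrak{X})\to\mathbb{R}$ be $\delta(f)=\|f\|_\infty$, $\sigma(f)=\sup_{\mathfrak{X}}f$, $\iota(f)=\inf_{\mathfrak{X}}f$, $\alpha(f)=\sup_{\mathfrak{X}}f-\inf_{\mathfrak{X}}f$. (a) The maps $\sigma$, $\iota$ and $\alpha$ are Hadamard directionally differentiable at $f\in\ell^\infty(\mathfrak{X})$ tangentially to the set $\mathcal{C}_u(\mathfrak{X},d)$ with derivatives, for $g\in\mathcal{C}_u(\mathfrak{X},d)$, $$\sigma'_f(g)=\sup_{\bar A_0(f)}\bar g,\qquad \iota'_f(g)=\inf_{\bar B_0(f)}\bar g,\qquad \alpha'_f(g)=\sup_{\bar A_0(f)}\bar g-\inf_{\bar B_0(f)}\bar g.$$ (b) If additionally $f\in\mathcal{C}_u(\mathfrak{X},d)\setminus\{0\}$, then $\delta,\sigma,\iota,\alpha$ are Hadamard directionally differentiable at $f$ tangentially to $\mathcal{C}_u(\mathfrak{X},d)$ with, for $g\in\mathcal{C}_u(\mathfrak{X},d)$, $$\delta'_f(g)=\sup_{\bar M^+(|f|)}\big(\bar g\cdot\operatorname{sgn}(\bar f)\big),\quad \sigma'_f(g)=\sup_{\bar M^+(f)}\bar g,\quad \iota'_f(g)=\inf_{\bar M^-(f)}\bar g,\quad \alpha'_f(g)=\sup_{\bar M^+(f)}\bar g-\inf_{\bar M^-(f)}\bar g.$$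
   Context: $\ell^\infty(\mathfrak{X})$ is the real Banach space of bounded functions $f:\mathfrak{X}\to\mathbb{R}$ with norm $\|f\|_\infty=\sup_{x\in\mathfrak{X}}|f(x)|$; $\operatorname{sgn}$ is the sign function. $\bar{\mathfrak{X}}$ is the completion of $\mathfrak{X}$ with respect to $d$ (a compact metric space). $\mathcal{C}_u(\mathfrak{X},d)$ is the space of bounded uniformly continuous functions $f:\mathfrak{X}\to\mathbb{R}$; each such $f$ has a unique continuous extension $\bar f$ to $\bar{\mathfrak{X}}$. For $h\in\ell^\infty(\mathfrak{X})$: $\bar A_0(h)=\{x\in\bar{\mathfrak{X}}:\exists\{x_n\}\subset\mathfrak{X},\ x_n\to x,\ h(x_n)\to\sup_{\mathfrak{X}}h\}$, $\bar B_0(h)=\{x\in\bar{\mathfrak{X}}:\exists\{x_n\}\subset\mathfrak{X},\ x_n\to x,\ h(x_n)\to\inf_{\mathfrak{X}}h\}$. For $h\in\mathcal{C}_u(\mathfrak{X},d)$: $\bar M^+(h)=\{x\in\bar{\mathfrak{X}}:\bar h(x)=\sup_{\mathfrak{X}}h\}$, $\bar M^-(h)=\{x\in\bar{\mathfrak{X}}:\bar h(x)=\inf_{\mathfrak{X}}h\}$. Hadamard directional differentiability: let $\mathcal{D},\mathcal{E}$ be real Banach spaces. A map $\phi:\mathcal{D}\to\mathcal{E}$ is Hadamard directionally differentiable at $\theta\in\mathcal{D}$ tangentially to a set $\mathcal{D}_0\subset\mathcal{D}$ if there is a map $\phi'_\theta:\mathcal{D}_0\to\mathcal{E}$ (the derivative,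 not required to be linear) such that $\big\|\frac{\phi(\theta+t_nh_n)-\phi(\theta)}{t_n}-\phi'_\theta(h)\big\|_{\mathcal{E}}\to0$ for all $h\in\mathcal{D}_0$ and all sequences $\{t_n\}\subset\mathbb{R}$, $\{h_n\}\subset\mathcal{D}$ with $t_n\downarrow0$ and $\|h_n-h\|_{\mathcal{D}}\to0$. *)

theory Defs
  imports "HOL-Analysis.Analysis"
begin

section \<open>The Banach space of bounded real functions\<close>

typedef 'a linf = "{f :: 'a \<Rightarrow> real. bounded (range f)}"
  morphisms apply_linf Linf
  by (rule exI[of _ "\<lambda>_. 0"]) (auto simp: bounded_def)

declare [[coercion "apply_linf :: 'a linf \<Rightarrow> 'a \<Rightarrow> real"]]

setup_lifting type_definition_linf

lemma linf_eqI: "(\<And>x. apply_linf f x = apply_linf g x) \<Longrightarrow> f = g"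
  by transfer auto

lemma bounded_apply_linf [simp, intro]: "bounded (range (apply_linf f))"
  by transfer auto

instantiation linf :: (type) real_vector
begin

lift_definition zero_linf :: "'a linf" is "\<lambda>_. 0"
  by (auto simp: bounded_def)

lift_definition plus_linf :: "'a linf \<Rightarrow> 'a linf \<Rightarrow> 'a linf" is "\<lambda>f g x. f x + g x"
  by (rule bounded_plus_comp)

lift_definition minus_linf :: "'a linf \<Rightarrow> 'a linf \<Rightarrow> 'a linf" is "\<lambda>f g x. f x - g x"
  by (rule bounded_minus_comp)

lift_definition uminus_linf :: "'a linf \<Rightarrow> 'a linf" is "\<lambda>f x. - f x"
  by auto

lift_definition scaleR_linf :: "real \<Rightarrow> 'a linf \<Rightarrow> 'a linf" is "\<lambda>r f x. r * f x"
  by (simp flip: real_scaleR_def add: bounded_scaleR_comp)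

instance
  by standard (transfer; auto simp: algebra_simps)+

end

lemmas linf_rep_eqs [simp] =
  zero_linf.rep_eq plus_linf.rep_eq minus_linf.rep_eq uminus_linf.rep_eq scaleR_linf.rep_eq

instantiation linf :: (type) real_normed_vector
begin

definition norm_linf :: "'a linf \<Rightarrow> real" where
  "norm_linf f = (SUP x. \<bar>apply_linf f x\<bar>)"

definition dist_linf :: "'a linf \<Rightarrow> 'a linf \<Rightarrow> real" where
  "dist_linf f g = norm (f - g)"

definition sgn_linf :: "'a linf \<Rightarrow> 'a linf" where
  "sgn_linf f = f /\<^sub>R norm f"

definition uniformity_linf :: "('a linf \<times> 'a linf) filter" where
  "uniformity_linf = (INF e\<in>{0<..}. principal {(x, y). dist x y < e})"

definition open_linf :: "'a linf set \<Rightarrow> bool" where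
  "open_linf S = (\<forall>x\<in>S. \<forall>\<^sub>F (x', y) in uniformity. x' = x \<longrightarrow> y \<in> S)"

lemma bdd_above_abs_linf: "bdd_above (range (\<lambda>x. \<bar>apply_linf f x\<bar>))"
  using bounded_apply_linf[of f] unfolding bounded_iff bdd_above_def by auto

lemma abs_apply_le_norm_linf: "\<bar>apply_linf f x\<bar> \<le> norm f"
  unfolding norm_linf_def by (rule cSUP_upper[OF _ bdd_above_abs_linf]) simp

lemma norm_linf_le: "(\<And>x. \<bar>apply_linf f x\<bar> \<le> b) \<Longrightarrow> norm f \<le> b"
  unfolding norm_linf_def by (rule cSUP_least) auto

instance
proof
  fix a :: real and f g :: "'a linf"
  show "norm f = 0 \<longleftrightarrow> f = 0"
  proof
    assume "norm f = 0"
    then show "f = 0"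
      using abs_apply_le_norm_linf[of f] by (intro linf_eqI) simp
  next
    assume "f = 0"
    then show "norm f = 0" by (simp add: norm_linf_def)
  qed
  show "norm (f + g) \<le> norm f + norm g"
  proof (rule norm_linf_le)
    fix x
    show "\<bar>apply_linf (f + g) x\<bar> \<le> norm f + norm g"
      using abs_apply_le_norm_linf[of f x] abs_apply_le_norm_linf[of g x] by simp
  qed
  have le: "norm (b *\<^sub>R h) \<le> \<bar>b\<bar> * norm h" for b :: real and h :: "'a linf"
    by (rule norm_linf_le) (simp add: abs_mult mult_left_mono abs_apply_le_norm_linf)
  show "norm (a *\<^sub>R f) = \<bar>a\<bar> * norm f"
  proof (cases "a = 0")
    case True
    then show ?thesis by (simp add: norm_linf_def)
  next
    case False
    have "norm f \<le> \<bar>inverse a\<bar> * norm (a *\<^sub>R f)"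
      using le[of "inverse a" "a *\<^sub>R f"] False by simp
    then have "\<bar>a\<bar> * norm f \<le> norm (a *\<^sub>R f)"
      using False by (simp add: field_simps)
    with le[of a f] show ?thesis by linarith
  qed
qed (rule dist_linf_def sgn_linf_def uniformity_linf_def open_linf_def)+

end

instance linf :: (type) banach
proof
  fix X :: "nat \<Rightarrow> 'a linf"
  assume "Cauchy X"
  have "\<forall>e>0. \<exists>N. \<forall>m n x. N \<le> m \<and> N \<le> n \<and> True \<longrightarrow> dist (X m x) (X n x) < e"
  proof (intro allI impI)
    fix e :: real
    assume "e > 0"
    then obtain N where N: "\<forall>m\<ge>N. \<forall>n\<ge>N. dist (X m) (X n) < e"
      using \<open>Cauchy X\<close> unfolding Cauchy_def by blast
    have "dist (X m x) (X n x) < e" if "N \<le> m" "N \<le> n" for m n x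
    proof -
      have "dist (X m x) (X n x) \<le> dist (X m) (X n)"
        using abs_apply_le_norm_linf[of "X m - X n" x] by (simp add: dist_linf_def dist_real_def)
      also have "\<dots> < e"
        using N that by blast
      finally show ?thesis .
    qed
    then show "\<exists>N. \<forall>m n x. N \<le> m \<and> N \<le> n \<and> True \<longrightarrow> dist (X m x) (X n x) < e"
      by blast
  qed
  then have "\<exists>l. \<forall>e>0. \<exists>N. \<forall>n x. N \<le> n \<and> True \<longrightarrow> dist (X n x) (l x) < e"
    by (subst uniformly_convergent_eq_cauchy)
  then obtain l where l: "\<And>e. e > 0 \<Longrightarrow> \<exists>N. \<forall>n x. N \<le> n \<longrightarrow> dist (X n x) (l x) < e"
    by auto
  obtain N where N: "dist (X N x) (l x) < 1" for x
    using l[OF zero_less_one] by blast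
  have "\<bar>l x\<bar> \<le> norm (X N) + 1" for x
    using abs_apply_le_norm_linf[of "X N" x] N[of x] by (simp add: dist_real_def)
  then have "bounded (range l)"
    by (auto simp: bounded_iff)
  then have L: "apply_linf (Linf l) = l"
    by (simp add: Linf_inverse)
  have "X \<longlonglongrightarrow> Linf l"
  proof (rule metric_LIMSEQ_I)
    fix e :: real
    assume "e > 0"
    then obtain M where M: "\<And>n x. M \<le> n \<Longrightarrow> dist (X n x) (l x) < e / 2"
      using l[of "e / 2"] by auto
    have "dist (X n) (Linf l) < e" if "n \<ge> M" for n
    proof -
      have "norm (X n - Linf l) \<le> e / 2"
        using M[OF that] by (intro norm_linf_le) (simp add: L dist_real_def less_imp_le)
      then show ?thesis using \<open>e > 0\<close> by (simp add: dist_linf_def)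
    qed
    then show "\<exists>no. \<forall>n\<ge>no. dist (X n) (Linf l) < e" by blast
  qed
  then show "convergent X" by (rule convergentI)
qed


section \<open>Completion of a metric space\<close>

text \<open>The completion is realised as the closure of the image of the Kuratowski embedding
  \<open>x \<mapsto> d(x, \<cdot>) - d(x\<^sub>0, \<cdot>)\<close> in the Banach space of bounded functions, where the base point
  \<open>x\<^sub>0\<close> is arbitrary. The characteristic properties (completeness, isometric embedding, dense
  image) are proved below.\<close>

lift_definition kuratowski :: "'a::metric_space \<Rightarrow> 'a linf" is
  "\<lambda>x y. dist x y - dist (undefined :: 'a) y"
proof -
  fix x :: 'a
  have "\<bar>dist x y - dist undefined y\<bar> \<le> dist x undefined" for y
    using abs_dist_diff_le[of x y undefined] by (simp add: dist_commute)
  then show "bounded (range (\<lambda>y. dist x y - dist undefined y))"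
    by (intro boundedI[of _ "dist x undefined"]) auto
qed

lemma dist_kuratowski: "dist (kuratowski x) (kuratowski y) = dist x y"
proof (rule antisym)
  show "dist (kuratowski x) (kuratowski y) \<le> dist x y"
    unfolding dist_linf_def
  proof (rule norm_linf_le)
    fix z
    show "\<bar>apply_linf (kuratowski x - kuratowski y) z\<bar> \<le> dist x y"
      using abs_dist_diff_le[of x z y] by (simp add: kuratowski.rep_eq dist_commute)
  qed
  show "dist x y \<le> dist (kuratowski x) (kuratowski y)"
    using abs_apply_le_norm_linf[of "kuratowski x - kuratowski y" y]
    by (simp add: dist_linf_def kuratowski.rep_eq)
qed

typedef (overloaded) 'a metric_completion =
  "closure (range (kuratowski :: 'a::metric_space \<Rightarrow> 'a linf))"
  by (rule exI[of _ "kuratowski undefined"]) (rule subsetD[OF closure_subset rangeI])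

instantiation metric_completion :: (metric_space) metric_space
begin

definition dist_metric_completion :: "'a metric_completion \<Rightarrow> 'a metric_completion \<Rightarrow> real" where
  "dist_metric_completion x y = dist (Rep_metric_completion x) (Rep_metric_completion y)"

definition uniformity_metric_completion ::
    "('a metric_completion \<times> 'a metric_completion) filter" where
  "uniformity_metric_completion = (INF e\<in>{0<..}. principal {(x, y). dist x y < e})"

definition open_metric_completion :: "'a metric_completion set \<Rightarrow> bool" where
  "open_metric_completion S = (\<forall>x\<in>S. \<forall>\<^sub>F (x', y) in uniformity. x' = x \<longrightarrow> y \<in> S)"

instance
proof
  fix x y z :: "'a metric_completion"
  show "dist x y = 0 \<longleftrightarrow> x = y"
    by (simp add: dist_metric_completion_def Rep_metric_completion_inject)
  show "dist x y \<le> dist x z + dist y z"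
    unfolding dist_metric_completion_def by (rule dist_triangle2)
qed (rule uniformity_metric_completion_def open_metric_completion_def)+

end

instance metric_completion :: (metric_space) complete_space
proof
  fix X :: "nat \<Rightarrow> 'a metric_completion"
  assume "Cauchy X"
  then have "Cauchy (\<lambda>n. Rep_metric_completion (X n))"
    by (simp add: Cauchy_def dist_metric_completion_def)
  then obtain l where l: "(\<lambda>n. Rep_metric_completion (X n)) \<longlonglongrightarrow> l"
    using Cauchy_convergent_iff convergent_def by blast
  then have "l \<in> closure (range kuratowski)"
    by (rule Lim_in_closed_set[OF closed_closure, rotated 2]) (auto simp: Rep_metric_completion)
  then obtain L where "l = Rep_metric_completion L"
    by (rule Rep_metric_completion_cases)
  with l have "X \<longlonglongrightarrow> L"
    by (simp add: tendsto_iff dist_metric_completion_def)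
  then show "convergent X" by (rule convergentI)
qed

definition to_completion :: "'a::metric_space \<Rightarrow> 'a metric_completion" where
  "to_completion x = Abs_metric_completion (kuratowski x)"

lemma Rep_to_completion: "Rep_metric_completion (to_completion x) = kuratowski x"
  unfolding to_completion_def
  by (rule Abs_metric_completion_inverse) (rule subsetD[OF closure_subset rangeI])

lemma dist_to_completion: "dist (to_completion x) (to_completion y) = dist x y"
  by (simp add: dist_metric_completion_def Rep_to_completion dist_kuratowski)

lemma closure_range_to_completion: "closure (range to_completion) = UNIV"
proof -
  have "x \<in> closure (range to_completion)" for x :: "'a metric_completion"
    using Rep_metric_completion[of x]
    by (auto simp: closure_approachable dist_metric_completion_def Rep_to_completion)
  then show ?thesis by blast
qed


section \<open>Uniformly continuous functions and their extensions\<close>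

text \<open>The space \<open>C\<^sub>u(X, d)\<close> of bounded uniformly continuous functions; boundedness is part of
  the type.\<close>

definition Cu :: "'a::metric_space linf set" where
  "Cu = {f. uniformly_continuous_on UNIV (apply_linf f)}"

definition cext :: "('a::metric_space \<Rightarrow> real) \<Rightarrow> 'a metric_completion \<Rightarrow> real" where
  "cext f = (THE F. continuous_on UNIV F \<and> (\<forall>x. F (to_completion x) = f x))"

lemma ex1_cext:
  fixes f :: "'a::metric_space \<Rightarrow> real"
  assumes "uniformly_continuous_on UNIV f"
  shows "\<exists>!F. continuous_on UNIV F \<and> (\<forall>x. F (to_completion x) = f x)"
proof -
  define i where "i = inv (to_completion :: 'a \<Rightarrow> _)"
  have "inj (to_completion :: 'a \<Rightarrow> _)"
    by (metis dist_eq_0_iff dist_to_completion injI)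
  then have i: "i (to_completion x) = x" for x
    by (simp add: i_def)
  have "uniformly_continuous_on (range to_completion) (\<lambda>y. f (i y))"
    using assms by (simp add: uniformly_continuous_on_def i dist_to_completion)
  then obtain F where F: "uniformly_continuous_on (closure (range to_completion)) F"
      "\<And>y. y \<in> range to_completion \<Longrightarrow> f (i y) = F y"
    by (rule uniformly_continuous_on_extension_on_closure) blast
  have F_cont: "continuous_on UNIV F"
    using uniformly_continuous_imp_continuous[OF F(1)] by (simp add: closure_range_to_completion)
  have F_eq: "F (to_completion x) = f x" for x
    using F(2)[of "to_completion x"] by (simp add: i)
  show ?thesis
  proof (rule ex1I[of _ F])
    show "continuous_on UNIV F \<and> (\<forall>x. F (to_completion x) = f x)"
      using F_cont F_eq by simp
  next
    fix G
    assume G: "continuous_on UNIV G \<and> (\<forall>x. G (to_completion x) = f x)"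
    have "closed {x. G x = F x}"
      using G F_cont by (intro closed_Collect_eq) simp_all
    moreover have "range to_completion \<subseteq> {x. G x = F x}"
      using G F_eq by (simp add: image_subset_iff)
    ultimately have "closure (range to_completion) \<subseteq> {x. G x = F x}"
      by (simp add: closure_minimal)
    then show "G = F"
      by (simp add: closure_range_to_completion fun_eq_iff set_eq_iff subset_iff)
  qed
qed

lemma
  assumes "uniformly_continuous_on UNIV f"
  shows continuous_on_cext: "continuous_on UNIV (cext f)"
    and cext_to_completion: "cext f (to_completion x) = f x"
  using theI'[OF ex1_cext[OF assms]] unfolding cext_def by blast+


section \<open>Sets of (asymptotic) extremal points\<close>

definition A0 :: "('a::metric_space \<Rightarrow> real) \<Rightarrow> 'a metric_completion set" where
  "A0 h = {x. \<exists>s :: nat \<Rightarrow> 'a.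
     (\<lambda>n. to_completion (s n)) \<longlonglongrightarrow> x \<and> (\<lambda>n. h (s n)) \<longlonglongrightarrow> (SUP y. h y)}"

definition B0 :: "('a::metric_space \<Rightarrow> real) \<Rightarrow> 'a metric_completion set" where
  "B0 h = {x. \<exists>s :: nat \<Rightarrow> 'a.
     (\<lambda>n. to_completion (s n)) \<longlonglongrightarrow> x \<and> (\<lambda>n. h (s n)) \<longlonglongrightarrow> (INF y. h y)}"

definition Mplus :: "('a::metric_space \<Rightarrow> real) \<Rightarrow> 'a metric_completion set" where
  "Mplus h = {x. cext h x = (SUP y. h y)}"

definition Mminus :: "('a::metric_space \<Rightarrow> real) \<Rightarrow> 'a metric_completion set" where
  "Mminus h = {x. cext h x = (INF y. h y)}"


section \<open>Hadamard directional differentiability\<close>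

text \<open>The values of \<open>\<phi>'\<close> outside \<open>D\<close> are irrelevant. The condition \<open>t\<^sub>n \<down> 0\<close> is read as
  \<open>t\<^sub>n > 0\<close> and \<open>t\<^sub>n \<rightarrow> 0\<close>; monotonicity of the sequence is not required.\<close>

definition has_hadamard_derivative ::
    "('d::banach \<Rightarrow> 'e::banach) \<Rightarrow> ('d \<Rightarrow> 'e) \<Rightarrow> 'd \<Rightarrow> 'd set \<Rightarrow> bool" where
  "has_hadamard_derivative \<phi> \<phi>' \<theta> D \<longleftrightarrow>
     (\<forall>h\<in>D. \<forall>(t :: nat \<Rightarrow> real) hs.
        (\<forall>n. t n > 0) \<longrightarrow> t \<longlonglongrightarrow> 0 \<longrightarrow> (\<lambda>n. norm (hs n - h)) \<longlonglongrightarrow> 0 \<longrightarrow>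
        (\<lambda>n. norm ((\<phi> (\<theta> + t n *\<^sub>R hs n) - \<phi> \<theta>) /\<^sub>R t n - \<phi>' h)) \<longlonglongrightarrow> 0)"

end

(* The difference quotient of a supremum is governed by the near-maximisers of f: they accumulate
   only at points of A0 f because the completion is compact, so near them the perturbation is
   essentially at most its supremum over A0 f, while all other points are out of play once the
   step is small. Infima are suprema of negatives. The norm is the supremum of |f|, whose
   perturbation is asymptotically g * sgn f near the maximisers; there sgn f is close to the
   continuous function f / norm f. *)

theory Submission
  imports Defs
begin

section \<open>Compactness of the completion\<close>

text \<open>The image of the space is dense, so a finite \<open>e / 2\<close>-net of the space is
  carried to an \<open>e\<close>-net of the completion; total boundedness and completeness together
  give compactness.\<close>

lemma compact_metric_completion:
  assumes "totally_bounded (UNIV :: 'a::metric_space set)"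
  shows "compact (UNIV :: 'a metric_completion set)"
  unfolding compact_eq_totally_bounded
proof (intro conjI allI impI)
  show "complete (UNIV :: 'a metric_completion set)"
    by (simp add: complete_UNIV)
  fix e :: real
  assume "e > 0"
  then obtain k :: "'a set" where k: "finite k" "UNIV \<subseteq> (\<Union>x\<in>k. {y. dist x y < e / 2})"
    using assms unfolding totally_bounded_metric by (meson half_gt_zero)
  have "x \<in> (\<Union>y\<in>to_completion ` k. ball y e)" for x :: "'a metric_completion"
  proof -
    obtain y :: 'a where y: "dist (to_completion y) x < e / 2"
      using closure_range_to_completion \<open>e > 0\<close> closure_approachable
      by (metis UNIV_I half_gt_zero rangeE)
    obtain z where "z \<in> k" "dist z y < e / 2"
      using k(2) by blast
    then have "dist (to_completion z) x < e"
      using y dist_triangle[of "to_completion z" x "to_completion y"]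
      by (simp add: dist_to_completion)
    with \<open>z \<in> k\<close> show ?thesis by auto
  qed
  then show "\<exists>k. finite k \<and> (UNIV :: 'a metric_completion set) \<subseteq> (\<Union>x\<in>k. ball x e)"
    using k(1) by (intro exI[of _ "to_completion ` k"]) blast
qed

section \<open>Maximising sequences and their accumulation points\<close>

lemma LIMSEQ_SUP:
  fixes f :: "'a \<Rightarrow> real"
  assumes "bdd_above (range f)" "\<And>n. (SUP y. f y) - inverse (real (Suc n)) < f (s n)"
  shows "(\<lambda>n. f (s n)) \<longlonglongrightarrow> (SUP y. f y)"
proof (rule tendsto_sandwich)
  show "\<forall>\<^sub>F n in sequentially. (SUP y. f y) - inverse (real (Suc n)) \<le> f (s n)"
    using assms(2) less_imp_le by (intro always_eventually) blast
  show "\<forall>\<^sub>F n in sequentially. f (s n) \<le> (SUP y. f y)"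
    by (intro always_eventually allI cSUP_upper assms(1)) simp
  show "(\<lambda>n. (SUP y. f y) - inverse (real (Suc n))) \<longlonglongrightarrow> (SUP y. f y)"
    using tendsto_diff[OF tendsto_const LIMSEQ_inverse_real_of_nat] by simp
qed simp

lemma maximising_seq_exists:
  fixes f :: "'a \<Rightarrow> real"
  assumes "bdd_above (range f)"
  obtains s :: "nat \<Rightarrow> 'a" where "(\<lambda>n. f (s n)) \<longlonglongrightarrow> (SUP y. f y)"
proof -
  have "\<exists>y. (SUP y. f y) - inverse (real (Suc n)) < f y" for n
    using less_cSUP_iff[OF _ assms, of "(SUP y. f y) - inverse (real (Suc n))"] by auto
  then obtain s where "\<And>n. (SUP y. f y) - inverse (real (Suc n)) < f (s n)"
    by metis
  then show thesis by (intro that LIMSEQ_SUP assms)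
qed

text \<open>A convergent subsequence exists by compactness, is still maximising, and so is itself
  the witness that its limit lies in \<open>A0 f\<close>. Applied to any maximising sequence, this
  also shows that \<open>A0 f\<close> is nonempty.\<close>

lemma maximising_seq_accumulates:
  fixes f :: "'a::metric_space \<Rightarrow> real" and s :: "nat \<Rightarrow> 'a"
  assumes "compact (UNIV :: 'a metric_completion set)"
    and "(\<lambda>n. f (s n)) \<longlonglongrightarrow> (SUP y. f y)"
  obtains x r where "x \<in> A0 f" "strict_mono (r :: nat \<Rightarrow> nat)"
    "(\<lambda>n. to_completion (s (r n))) \<longlonglongrightarrow> x"
proof -
  obtain x r where r: "strict_mono (r :: nat \<Rightarrow> nat)"
      and x: "((\<lambda>n. to_completion (s n)) \<circ> r) \<longlonglongrightarrow> x"
    using assms(1)[unfolded compact_def, rule_format, of "\<lambda>n. to_completion (s n)"] by auto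
  have lim: "(\<lambda>n. to_completion (s (r n))) \<longlonglongrightarrow> x"
    using x by (simp add: o_def)
  moreover have "(\<lambda>n. f (s (r n))) \<longlonglongrightarrow> (SUP y. f y)"
    using LIMSEQ_subseq_LIMSEQ[OF assms(2) r] by (simp add: o_def)
  ultimately have "x \<in> A0 f"
    unfolding A0_def by (intro CollectI exI[of _ "s \<circ> r"]) (simp add: o_def)
  then show thesis using r lim by (rule that)
qed

text \<open>If every \<open>c\<close> failed, counterexamples for \<open>c = 1 / (n + 1)\<close>
  would form a maximising sequence; at its accumulation point \<open>x\<close> in
  \<open>A0 f\<close>, continuity of \<open>G\<close> would give \<open>S \<le> G x\<close>.\<close>

lemma near_maximisers:
  fixes f :: "'a::metric_space \<Rightarrow> real"
  assumes "compact (UNIV :: 'a metric_completion set)" "bdd_above (range f)"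
    and G: "continuous_on UNIV G" and S: "\<And>x. x \<in> A0 f \<Longrightarrow> G x < (S :: real)"
  shows "\<exists>c>0. \<forall>y. f y > (SUP y. f y) - c \<longrightarrow> G (to_completion y) < S"
proof (rule ccontr)
  assume "\<not> ?thesis"
  then have "\<exists>y. f y > (SUP y. f y) - c \<and> G (to_completion y) \<ge> S" if "c > 0" for c
    using that by (meson not_less)
  then have "\<exists>y. f y > (SUP y. f y) - inverse (real (Suc n)) \<and> G (to_completion y) \<ge> S" for n
    by simp
  then obtain s where s: "\<And>n. f (s n) > (SUP y. f y) - inverse (real (Suc n))"
      "\<And>n. G (to_completion (s n)) \<ge> S"
    by metis
  have "(\<lambda>n. f (s n)) \<longlonglongrightarrow> (SUP y. f y)"
    using assms(2) s(1) by (rule LIMSEQ_SUP)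
  then obtain x r where x: "x \<in> A0 f" "(\<lambda>n. to_completion (s (r n))) \<longlonglongrightarrow> x"
    using maximising_seq_accumulates[OF assms(1)] by metis
  have "(\<lambda>n. G (to_completion (s (r n)))) \<longlonglongrightarrow> G x"
    using G x(2) by (rule continuous_on_tendsto_compose) auto
  then have "S \<le> G x"
    by (rule LIMSEQ_le_const) (use s(2) in blast)
  with S[OF x(1)] show False by simp
qed

section \<open>Difference quotients of a perturbed supremum\<close>

text \<open>The common core of all the derivatives. The directions \<open>k n\<close> have to
  approach \<open>G\<close> only near the maximisers of \<open>f\<close> and are merely bounded
  above elsewhere; this generality is what the norm requires, where \<open>k n\<close> is a
  difference quotient of the absolute value.\<close>

lemma tendsto_SUP_difference_quotient:
  fixes f :: "'a::metric_space \<Rightarrow> real" and k :: "nat \<Rightarrow> 'a \<Rightarrow> real"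
  assumes cpt: "compact (UNIV :: 'a metric_completion set)"
    and f: "bdd_above (range f)"
    and G: "continuous_on UNIV G"
    and t: "\<And>n. t n > 0" "t \<longlonglongrightarrow> 0"
    and K: "\<forall>\<^sub>F n in sequentially. \<forall>y. k n y \<le> K"
    and close: "\<And>e. e > 0 \<Longrightarrow> \<exists>c>0. \<forall>\<^sub>F n in sequentially.
      \<forall>y. f y > (SUP y. f y) - c \<longrightarrow> \<bar>k n y - G (to_completion y)\<bar> \<le> e"
  shows "(\<lambda>n. ((SUP y. f y + t n * k n y) - (SUP y. f y)) / t n) \<longlonglongrightarrow> (SUP x\<in>A0 f. G x)"
proof -
  let ?m = "SUP y. f y" and ?S = "SUP x\<in>A0 f. G x"
  have fle: "f y \<le> ?m" for y
    by (rule cSUP_upper[OF _ f]) simp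
  \<comment> \<open>A real supremum carries information only over a nonempty set that is bounded
    above, so these side conditions are settled first, for \<open>A0 f\<close> and for the perturbed
    functions.\<close>
  obtain s where "(\<lambda>n. f (s n)) \<longlonglongrightarrow> ?m"
    using maximising_seq_exists[OF f] .
  then have ne: "A0 f \<noteq> {}"
    using maximising_seq_accumulates[OF cpt] by blast
  have bddG: "bdd_above (G ` A0 f)"
    using compact_imp_bounded[OF compact_continuous_image[OF G cpt]]
    by (meson bdd_above_mono bounded_imp_bdd_above image_mono top_greatest)
  have "bdd_above (range (\<lambda>y. f y + t n * k n y))" if "\<forall>y. k n y \<le> K" for n
    using fle t(1)[of n] that by (intro bdd_aboveI2[of _ _ "?m + t n * K"] add_mono mult_left_mono) auto
  with K have bdd: "\<forall>\<^sub>F n in sequentially. bdd_above (range (\<lambda>y. f y + t n * k n y))"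
    by (rule eventually_mono)
  show ?thesis
  proof (rule order_tendstoI)
    fix a assume "a < ?S"
    then obtain x where x: "x \<in> A0 f" "a < G x"
      using less_cSUP_iff[OF ne bddG] by blast
    \<comment> \<open>Lower half: \<open>e\<close> is half the gap, which leaves
      \<open>a < G x - e\<close>.\<close>
    define e where "e = (G x - a) / 2"
    have "e > 0" using x by (simp add: e_def)
    then obtain c where "c > 0" and c: "\<forall>\<^sub>F n in sequentially.
        \<forall>y. f y > ?m - c \<longrightarrow> \<bar>k n y - G (to_completion y)\<bar> \<le> e"
      using close by blast
    from x(1) obtain s where s: "(\<lambda>n. to_completion (s n)) \<longlonglongrightarrow> x" "(\<lambda>n. f (s n)) \<longlonglongrightarrow> ?m"
      unfolding A0_def by blast
    have Gs: "(\<lambda>j. G (to_completion (s j))) \<longlonglongrightarrow> G x"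
      using G s(1) by (rule continuous_on_tendsto_compose) auto
    have near: "\<forall>\<^sub>F j in sequentially. f (s j) > ?m - c"
      using s(2) \<open>c > 0\<close> by (intro order_tendstoD) auto
    show "\<forall>\<^sub>F n in sequentially. a < ((SUP y. f y + t n * k n y) - ?m) / t n"
      using c bdd
    proof eventually_elim
      case (elim n)
      note close_n = elim(1) and bdd_n = elim(2)
      \<comment> \<open>Here \<open>n\<close> is fixed and \<open>j\<close> tends to infinity: the
        supremum of \<open>f\<close> need not be attained, so the perturbed function is tested along
        a whole sequence approaching \<open>x\<close>.\<close>
      have "(\<lambda>j. f (s j) + t n * (G (to_completion (s j)) - e)) \<longlonglongrightarrow> ?m + t n * (G x - e)"
        by (intro tendsto_intros s Gs)
      moreover have "\<forall>\<^sub>F j in sequentially.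
          f (s j) + t n * (G (to_completion (s j)) - e) \<le> (SUP y. f y + t n * k n y)"
        using near
      proof eventually_elim
        case (elim j)
        have "f (s j) + t n * (G (to_completion (s j)) - e) \<le> f (s j) + t n * k n (s j)"
          using close_n[rule_format, OF elim] t(1)[of n]
          by (intro add_left_mono mult_left_mono) auto
        also have "\<dots> \<le> (SUP y. f y + t n * k n y)"
          by (rule cSUP_upper[OF _ bdd_n]) simp
        finally show ?case .
      qed
      ultimately have "?m + t n * (G x - e) \<le> (SUP y. f y + t n * k n y)"
        by (intro tendsto_upperbound) auto
      then have "G x - e \<le> ((SUP y. f y + t n * k n y) - ?m) / t n"
        using t(1)[of n] by (simp add: field_simps)
      moreover have "a < G x - e"
        using x(2) by (simp add: e_def field_simps)
      ultimately show ?case by simp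
    qed
  next
    fix a assume "?S < a"
    \<comment> \<open>Upper half: one \<open>e\<close> is lost when \<open>G\<close> is compared
      with \<open>?S\<close> near the maximisers, a second when \<open>k n\<close> is replaced by
      \<open>G\<close>; a third of the gap keeps \<open>?S + 2 * e\<close> below
      \<open>a\<close>.\<close>
    define e where "e = (a - ?S) / 3"
    have "e > 0" using \<open>?S < a\<close> by (simp add: e_def)
    have "G x < ?S + e" if "x \<in> A0 f" for x
      using cSUP_upper[OF that bddG] \<open>e > 0\<close> by linarith
    then obtain c where "c > 0" and c: "\<And>y. f y > ?m - c \<Longrightarrow> G (to_completion y) < ?S + e"
      using near_maximisers[OF cpt f G] by metis
    obtain c' where "c' > 0" and c': "\<forall>\<^sub>F n in sequentially.
        \<forall>y. f y > ?m - c' \<longrightarrow> \<bar>k n y - G (to_completion y)\<bar> \<le> e"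
      using close[OF \<open>e > 0\<close>] by blast
    \<comment> \<open>A point with \<open>f y \<le> ?m - min c c'\<close> gains at most
      \<open>t n * K\<close> from the perturbation. Once \<open>t n * (K - (?S + 2 * e))\<close> is
      below \<open>min c c'\<close>, this cannot lift it above
      \<open>?m + t n * (?S + 2 * e)\<close>.\<close>
    have "(\<lambda>n. t n * (K - (?S + 2 * e))) \<longlonglongrightarrow> 0 * (K - (?S + 2 * e))"
      by (intro tendsto_intros t)
    then have small: "\<forall>\<^sub>F n in sequentially. t n * (K - (?S + 2 * e)) < min c c'"
      using \<open>c > 0\<close> \<open>c' > 0\<close> by (intro order_tendstoD) auto
    show "\<forall>\<^sub>F n in sequentially. ((SUP y. f y + t n * k n y) - ?m) / t n < a"
      using c' small K
    proof eventually_elim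
      case (elim n)
      have "f y + t n * k n y \<le> ?m + t n * (?S + 2 * e)" for y
      proof (cases "f y > ?m - min c c'")
        case True
        then have "k n y \<le> ?S + 2 * e"
          using c[of y] elim(1)[rule_format, of y] by linarith
        then show ?thesis
          using fle[of y] t(1)[of n] by (intro add_mono mult_left_mono) auto
      next
        case False
        have "t n * k n y \<le> t n * K"
          using elim(3) t(1)[of n] by (intro mult_left_mono) auto
        with False elim(2) show ?thesis unfolding right_diff_distrib by linarith
      qed
      then have "(SUP y. f y + t n * k n y) \<le> ?m + t n * (?S + 2 * e)"
        by (intro cSUP_least) auto
      then have "((SUP y. f y + t n * k n y) - ?m) / t n \<le> ?S + 2 * e"
        using t(1)[of n] by (simp add: field_simps)
      also have "\<dots> < a"
        using \<open>e > 0\<close> by (simp add: e_def field_simps)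
      finally show ?case .
    qed
  qed
qed

section \<open>Level sets of the extension; infima as suprema\<close>

lemma bdd_above_linf: "bdd_above (range (apply_linf f))"
  by (simp add: bounded_imp_bdd_above)

lemma bdd_above_uminus_linf: "bdd_above (range (\<lambda>x. - apply_linf f x))"
  using bdd_above_linf[of "- f"] by simp

lemma cext_eqI:
  assumes "continuous_on UNIV F" "\<And>x. F (to_completion x) = f x"
    and "uniformly_continuous_on UNIV f"
  shows "cext f = F"
  unfolding cext_def using assms by (intro the1_equality ex1_cext) auto

text \<open>Along every sequence tending to \<open>x\<close> the values of \<open>f\<close> tend to
  \<open>cext f x\<close>, so the choice of the sequence does not matter; density provides at least
  one. A general level \<open>u\<close> serves the supremum and the infimum alike.\<close>

lemma cext_level_set:
  fixes f :: "'a::metric_space \<Rightarrow> real"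
  assumes "uniformly_continuous_on UNIV f"
  shows "{x. \<exists>s :: nat \<Rightarrow> 'a. (\<lambda>n. to_completion (s n)) \<longlonglongrightarrow> x \<and> (\<lambda>n. f (s n)) \<longlonglongrightarrow> u}
    = {x. cext f x = u}"
proof -
  have lim: "(\<lambda>n. f (s n)) \<longlonglongrightarrow> u \<longleftrightarrow> cext f x = u"
    if "(\<lambda>n. to_completion (s n)) \<longlonglongrightarrow> x" for s :: "nat \<Rightarrow> 'a" and x
  proof -
    have "(\<lambda>n. f (s n)) \<longlonglongrightarrow> cext f x"
      using continuous_on_tendsto_compose[OF continuous_on_cext[OF assms] that]
      by (simp add: cext_to_completion[OF assms])
    then show ?thesis by (auto intro: LIMSEQ_unique)
  qed
  have "\<exists>s. (\<lambda>n. to_completion (s n)) \<longlonglongrightarrow> x" for x :: "'a metric_completion"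
  proof -
    have "x \<in> closure (range to_completion)"
      by (simp add: closure_range_to_completion)
    then obtain z where z: "\<And>n. z n \<in> range to_completion" "z \<longlonglongrightarrow> x"
      unfolding closure_sequential by blast
    then have "\<forall>n. \<exists>y. z n = to_completion y"
      by blast
    then obtain s where "z = (\<lambda>n. to_completion (s n))"
      by metis
    with z(2) show ?thesis by blast
  qed
  then show ?thesis
    using lim by blast
qed

lemma A0_eq_Mplus: "uniformly_continuous_on UNIV f \<Longrightarrow> A0 f = Mplus f"
  unfolding A0_def Mplus_def by (rule cext_level_set)

lemma B0_eq_Mminus: "uniformly_continuous_on UNIV f \<Longrightarrow> B0 f = Mminus f"
  unfolding B0_def Mminus_def by (rule cext_level_set)

text \<open>This is how \<open>Inf\<close> is defined on the reals; it reduces statements on infima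
  to suprema of negatives.\<close>

lemma INF_eq_uminus_SUP: "(INF x\<in>A. f x) = - (SUP x\<in>A. - f x :: real)"
  by (simp add: Inf_real_def image_image)

lemma B0_eq_A0_uminus: "B0 f = A0 (\<lambda>x. - f x)"
  unfolding A0_def B0_def INF_eq_uminus_SUP tendsto_minus_cancel_left ..

section \<open>Rules for Hadamard derivatives and converging directions\<close>

lemma has_hadamard_derivative_realI:
  fixes \<phi> :: "'d::banach \<Rightarrow> real"
  assumes "\<And>h t hs. h \<in> D \<Longrightarrow> (\<And>n. t n > 0) \<Longrightarrow> t \<longlonglongrightarrow> 0 \<Longrightarrow> hs \<longlonglongrightarrow> h \<Longrightarrow>
    (\<lambda>n. (\<phi> (\<theta> + t n *\<^sub>R hs n) - \<phi> \<theta>) / t n) \<longlonglongrightarrow> \<phi>' h"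
  shows "has_hadamard_derivative \<phi> \<phi>' \<theta> D"
  unfolding has_hadamard_derivative_def
proof (intro ballI allI impI)
  fix h and t :: "nat \<Rightarrow> real" and hs
  assume "h \<in> D" "\<forall>n. t n > 0" "t \<longlonglongrightarrow> 0" "(\<lambda>n. norm (hs n - h)) \<longlonglongrightarrow> 0"
  moreover from this have "hs \<longlonglongrightarrow> h"
    using LIM_zero_cancel tendsto_norm_zero_iff by blast
  ultimately have "(\<lambda>n. (\<phi> (\<theta> + t n *\<^sub>R hs n) - \<phi> \<theta>) / t n) \<longlonglongrightarrow> \<phi>' h"
    by (intro assms) auto
  then show "(\<lambda>n. norm ((\<phi> (\<theta> + t n *\<^sub>R hs n) - \<phi> \<theta>) /\<^sub>R t n - \<phi>' h)) \<longlonglongrightarrow> 0"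
    by (intro tendsto_norm_zero LIM_zero) (simp add: divide_inverse_commute)
qed

lemma has_hadamard_derivative_diff:
  fixes \<phi> \<psi> :: "'d::banach \<Rightarrow> 'e::banach"
  assumes "has_hadamard_derivative \<phi> \<phi>' \<theta> D" "has_hadamard_derivative \<psi> \<psi>' \<theta> D"
  shows "has_hadamard_derivative (\<lambda>h. \<phi> h - \<psi> h) (\<lambda>h. \<phi>' h - \<psi>' h) \<theta> D"
  unfolding has_hadamard_derivative_def
proof (intro ballI allI impI)
  fix h :: 'd and t :: "nat \<Rightarrow> real" and hs
  let ?q = "\<lambda>(\<phi> :: 'd \<Rightarrow> 'e) \<phi>' n. (\<phi> (\<theta> + t n *\<^sub>R hs n) - \<phi> \<theta>) /\<^sub>R t n - \<phi>' h"
  assume "h \<in> D" "\<forall>n. t n > 0" "t \<longlonglongrightarrow> 0" "(\<lambda>n. norm (hs n - h)) \<longlonglongrightarrow> 0"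
  then have "?q \<phi> \<phi>' \<longlonglongrightarrow> 0" "?q \<psi> \<psi>' \<longlonglongrightarrow> 0"
    using assms unfolding has_hadamard_derivative_def by (blast intro: tendsto_norm_zero_cancel)+
  from tendsto_diff[OF this]
  show "(\<lambda>n. norm (?q (\<lambda>h. \<phi> h - \<psi> h) (\<lambda>h. \<phi>' h - \<psi>' h) n)) \<longlonglongrightarrow> 0"
    by (intro tendsto_norm_zero) (simp add: algebra_simps)
qed

text \<open>Supplies the eventual bound \<open>K\<close> on the directions that the core limit asks
  for.\<close>

lemma eventually_norm_le:
  assumes "hs \<longlonglongrightarrow> h"
  shows "\<forall>\<^sub>F n in sequentially. norm (hs n) \<le> norm h + 1"
  using order_tendstoD(2)[OF tendsto_norm[OF assms], of "norm h + 1"]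
  by (auto elim: eventually_mono)

lemma eventually_linf_close:
  assumes "hs \<longlonglongrightarrow> g" "e > 0"
  shows "\<forall>\<^sub>F n in sequentially. \<forall>y. \<bar>apply_linf (hs n) y - apply_linf g y\<bar> \<le> e"
  using tendstoD[OF assms]
proof eventually_elim
  case (elim n)
  show ?case
  proof
    fix y
    show "\<bar>apply_linf (hs n) y - apply_linf g y\<bar> \<le> e"
      using abs_apply_le_norm_linf[of "hs n - g" y] elim by (simp add: dist_norm)
  qed
qed

section \<open>Derivatives of supremum and infimum\<close>

lemma has_hadamard_derivative_SUP:
  fixes f :: "'a::metric_space linf"
  assumes "totally_bounded (UNIV :: 'a set)"
  shows "has_hadamard_derivative (\<lambda>h :: 'a linf. SUP x. h x) (\<lambda>g. SUP x\<in>A0 f. cext g x) f Cu"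
proof (rule has_hadamard_derivative_realI)
  fix g :: "'a linf" and t :: "nat \<Rightarrow> real" and hs
  assume g: "g \<in> Cu" and t: "\<And>n. t n > 0" "t \<longlonglongrightarrow> 0" and hs: "hs \<longlonglongrightarrow> g"
  then have g': "uniformly_continuous_on UNIV g" by (simp add: Cu_def)
  have "\<forall>\<^sub>F n in sequentially. \<forall>y. hs n y \<le> norm g + 1"
    using eventually_norm_le[OF hs]
    by eventually_elim (meson abs_apply_le_norm_linf abs_le_D1 order_trans)
  \<comment> \<open>The directions converge uniformly on the whole space, so closeness is not
    confined to near-maximisers and \<open>c = 1\<close> is an arbitrary choice.\<close>
  moreover have "\<exists>c>0. \<forall>\<^sub>F n in sequentially.
      \<forall>y. f y > (SUP y. f y) - c \<longrightarrow> \<bar>hs n y - cext g (to_completion y)\<bar> \<le> e" if "e > 0" for e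
    using eventually_linf_close[OF hs that]
    by (intro exI[of _ 1]) (auto simp: cext_to_completion[OF g'] elim: eventually_mono)
  ultimately show "(\<lambda>n. ((SUP x. (f + t n *\<^sub>R hs n) x) - (SUP x. f x)) / t n) \<longlonglongrightarrow> (SUP x\<in>A0 f. cext g x)"
    using tendsto_SUP_difference_quotient[OF compact_metric_completion[OF assms] bdd_above_linf
        continuous_on_cext[OF g'] t, where k = "\<lambda>n. apply_linf (hs n)"] by simp
qed

text \<open>The core limit for \<open>- f\<close> with directions \<open>- hs n\<close>: the
  maximising sequences of \<open>- f\<close> are the minimising sequences of \<open>f\<close>,
  whence \<open>B0 f\<close> appears.\<close>

lemma has_hadamard_derivative_INF:
  fixes f :: "'a::metric_space linf"
  assumes "totally_bounded (UNIV :: 'a set)"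
  shows "has_hadamard_derivative (\<lambda>h :: 'a linf. INF x. h x) (\<lambda>g. INF x\<in>B0 f. cext g x) f Cu"
proof (rule has_hadamard_derivative_realI)
  fix g :: "'a linf" and t :: "nat \<Rightarrow> real" and hs
  assume g: "g \<in> Cu" and t: "\<And>n. t n > 0" "t \<longlonglongrightarrow> 0" and hs: "hs \<longlonglongrightarrow> g"
  then have g': "uniformly_continuous_on UNIV g" by (simp add: Cu_def)
  have "- hs n y \<le> norm g + 1" if "norm (hs n) \<le> norm g + 1" for n y
    using abs_apply_le_norm_linf[of "hs n" y] that by linarith
  then have "\<forall>\<^sub>F n in sequentially. \<forall>y. - hs n y \<le> norm g + 1"
    using eventually_norm_le[OF hs] by (auto elim: eventually_mono)
  moreover have "\<exists>c>0. \<forall>\<^sub>F n in sequentially. \<forall>y. - f y > (SUP y. - f y) - c \<longrightarrow>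
      \<bar>- hs n y - - cext g (to_completion y)\<bar> \<le> e" if "e > 0" for e
    using eventually_linf_close[OF hs that]
    by (intro exI[of _ 1])
      (auto simp: cext_to_completion[OF g'] abs_minus_commute elim: eventually_mono)
  ultimately have "(\<lambda>n. ((SUP y. - f y + t n * - hs n y) - (SUP y. - f y)) / t n)
      \<longlonglongrightarrow> (SUP x\<in>B0 f. - cext g x)"
    unfolding B0_eq_A0_uminus
    by (intro tendsto_SUP_difference_quotient[OF compact_metric_completion[OF assms]
        bdd_above_uminus_linf continuous_on_minus[OF continuous_on_cext[OF g']] t])
  from tendsto_minus[OF this]
  show "(\<lambda>n. ((INF x. (f + t n *\<^sub>R hs n) x) - (INF x. f x)) / t n) \<longlonglongrightarrow> (INF x\<in>B0 f. cext g x)"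
    unfolding INF_eq_uminus_SUP by (simp add: minus_divide_left algebra_simps)
qed

section \<open>Derivative of the norm\<close>

text \<open>So small a perturbation cannot change the sign of \<open>a\<close>, and on either side
  of zero the absolute value is linear.\<close>

lemma abs_add_eq_sgn:
  fixes a b :: real
  assumes "\<bar>b\<bar> < \<bar>a\<bar>"
  shows "\<bar>a + b\<bar> = \<bar>a\<bar> + sgn a * b"
  using assms by (auto simp: sgn_if abs_if split: if_splits)

lemma has_hadamard_derivative_norm:
  fixes f :: "'a::metric_space linf"
  assumes tb: "totally_bounded (UNIV :: 'a set)" and f: "f \<in> Cu" "f \<noteq> 0"
  shows "has_hadamard_derivative (\<lambda>h :: 'a linf. norm h)
    (\<lambda>g. SUP x\<in>Mplus (\<lambda>y. \<bar>f y\<bar>). cext g x * sgn (cext f x)) f Cu"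
proof (rule has_hadamard_derivative_realI)
  fix g :: "'a linf" and t :: "nat \<Rightarrow> real" and hs
  assume g: "g \<in> Cu" and t: "\<And>n. t n > 0" "t \<longlonglongrightarrow> 0" and hs: "hs \<longlonglongrightarrow> g"
  have f': "uniformly_continuous_on UNIV f" and g': "uniformly_continuous_on UNIV g"
    using f g by (simp_all add: Cu_def)
  define m where "m = norm f"
  \<comment> \<open>The added 1 makes \<open>C\<close> an eventual bound for
    \<open>norm (hs n)\<close> and keeps it positive for the division by \<open>C\<close>
    below.\<close>
  define C where "C = norm g + 1"
  have "m > 0" "C > 0"
    using f by (auto simp: m_def C_def intro: add_nonneg_pos)
  have m: "(SUP y. \<bar>f y\<bar>) = m"
    by (simp add: m_def norm_linf_def)
  \<comment> \<open>The sign of \<open>cext f\<close> may jump at its zeros, while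
    \<open>cext f x / m\<close> is continuous and equals the sign wherever
    \<open>\<bar>cext f x\<bar> = m\<close>.\<close>
  define G where "G x = cext g x * cext f x / m" for x
  \<comment> \<open>The exact difference quotient, so that
    \<open>\<bar>f y\<bar> + t n * k n y\<close> is \<open>\<bar>f y + t n * hs n y\<bar>\<close>
    and its supremum is the norm of the perturbed function.\<close>
  define k where "k n y = (\<bar>f y + t n * hs n y\<bar> - \<bar>f y\<bar>) / t n" for n y
  have abs_f: "uniformly_continuous_on UNIV (\<lambda>y. \<bar>f y\<bar>)"
    using uniformly_continuous_on_norm[OF f'] by simp
  have Mplus: "\<bar>cext f x\<bar> = m" if "x \<in> Mplus (\<lambda>y. \<bar>f y\<bar>)" for x
  proof -
    have "cext (\<lambda>y. \<bar>f y\<bar>) = (\<lambda>x. \<bar>cext f x\<bar>)"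
      using f' abs_f by (intro cext_eqI continuous_intros continuous_on_cext)
        (simp_all add: cext_to_completion)
    with that show ?thesis by (simp add: Mplus_def m)
  qed
  have G_eq: "cext g x * sgn (cext f x) = G x" if "x \<in> Mplus (\<lambda>y. \<bar>f y\<bar>)" for x
    using Mplus[OF that] \<open>m > 0\<close> by (auto simp: G_def sgn_if abs_if split: if_splits)
  have bound: "\<bar>hs n y\<bar> \<le> C" if "norm (hs n) \<le> C" for n y
    using abs_apply_le_norm_linf[of "hs n" y] that by linarith
  have le_C: "\<forall>\<^sub>F n in sequentially. norm (hs n) \<le> C"
    unfolding C_def by (rule eventually_norm_le[OF hs])
  have "k n y \<le> C" if "norm (hs n) \<le> C" for n y
  proof -
    have "\<bar>f y + t n * hs n y\<bar> \<le> \<bar>f y\<bar> + t n * \<bar>hs n y\<bar>"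
      using t(1)[of n] abs_triangle_ineq[of "f y" "t n * hs n y"] by (simp add: abs_mult)
    also have "\<dots> \<le> \<bar>f y\<bar> + t n * C"
      using bound[OF that] t(1)[of n] by (intro add_left_mono mult_left_mono) auto
    finally show ?thesis
      using t(1)[of n] by (simp add: k_def field_simps)
  qed
  with le_C have K: "\<forall>\<^sub>F n in sequentially. \<forall>y. k n y \<le> C"
    by (auto elim: eventually_mono)
  have close: "\<exists>c>0. \<forall>\<^sub>F n in sequentially.
      \<forall>y. \<bar>f y\<bar> > (SUP y. \<bar>f y\<bar>) - c \<longrightarrow> \<bar>k n y - G (to_completion y)\<bar> \<le> e" if "e > 0" for e
  proof -
    \<comment> \<open>The first bound gives \<open>\<bar>f y\<bar> > m / 2\<close>, which exceeds
      \<open>t n * C\<close> for large \<open>n\<close>, so the sign of \<open>f y\<close> survives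
      the perturbation. The second gives \<open>C * (c / m) \<le> e / 2\<close>, the price of
      replacing the sign by \<open>f y / m\<close>.\<close>
    define c where "c = min (m / 2) (e / 2 * m / C)"
    have "c > 0"
      using \<open>m > 0\<close> \<open>C > 0\<close> \<open>e > 0\<close> by (simp add: c_def)
    have "(\<lambda>n. t n * C) \<longlonglongrightarrow> 0 * C"
      by (intro tendsto_intros t)
    then have small: "\<forall>\<^sub>F n in sequentially. t n * C < m / 2"
      using \<open>m > 0\<close> by (intro order_tendstoD) auto
    have "\<forall>\<^sub>F n in sequentially. \<forall>y. \<bar>f y\<bar> > m - c \<longrightarrow> \<bar>k n y - G (to_completion y)\<bar> \<le> e"
      using small le_C eventually_linf_close[OF hs half_gt_zero[OF \<open>e > 0\<close>]]
    proof eventually_elim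
      case (elim n)
      show ?case
      proof (intro allI impI)
        fix y
        assume y: "\<bar>f y\<bar> > m - c"
        have "\<bar>t n * hs n y\<bar> \<le> t n * C"
          using bound[OF elim(2), of y] t(1)[of n] by (simp add: abs_mult)
        also have "\<dots> < \<bar>f y\<bar>"
          using y elim(1) by (simp add: c_def)
        finally have k: "k n y = sgn (f y) * hs n y"
          using t(1)[of n] by (simp add: k_def abs_add_eq_sgn)
        have fy: "f y = sgn (f y) * \<bar>f y\<bar>" "\<bar>f y\<bar> \<le> m" "\<bar>g y\<bar> \<le> C"
          using abs_apply_le_norm_linf[of f y] abs_apply_le_norm_linf[of g y]
          by (simp_all add: sgn_mult_abs m_def C_def)
        have "G (to_completion y) = g y * f y / m"
          by (simp add: G_def cext_to_completion[OF f'] cext_to_completion[OF g'])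
        also have "\<dots> = sgn (f y) * (g y * \<bar>f y\<bar> / m)"
          by (subst fy(1)) (simp add: mult_ac)
        \<comment> \<open>Splits the error into the distance of \<open>hs n\<close> from
          \<open>g\<close> and the defect \<open>1 - \<bar>f y\<bar> / m\<close> of
          \<open>f y / m\<close> as a sign.\<close>
        finally have "k n y - G (to_completion y)
            = sgn (f y) * ((hs n y - g y) + g y * ((m - \<bar>f y\<bar>) / m))"
          using \<open>m > 0\<close> by (simp add: k field_simps)
        then have "\<bar>k n y - G (to_completion y)\<bar>
            \<le> \<bar>(hs n y - g y) + g y * ((m - \<bar>f y\<bar>) / m)\<bar>"
          by (simp add: abs_mult abs_sgn_eq)
        also have "\<dots> \<le> \<bar>hs n y - g y\<bar> + \<bar>g y\<bar> * ((m - \<bar>f y\<bar>) / m)"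
          using fy(2) \<open>m > 0\<close> abs_triangle_ineq[of "hs n y - g y" "g y * ((m - \<bar>f y\<bar>) / m)"]
          by (simp add: abs_mult)
        also have "\<dots> \<le> e / 2 + C * (c / m)"
          using elim(3) y fy \<open>m > 0\<close> \<open>C > 0\<close>
          by (intro add_mono mult_mono divide_right_mono) auto
        also have "\<dots> \<le> e / 2 + C * ((e / 2 * m / C) / m)"
          using \<open>m > 0\<close> \<open>C > 0\<close>
          by (intro add_left_mono mult_left_mono divide_right_mono) (auto simp: c_def)
        also have "\<dots> = e"
          using \<open>m > 0\<close> \<open>C > 0\<close> by simp
        finally show "\<bar>k n y - G (to_completion y)\<bar> \<le> e" .
      qed
    qed
    with \<open>c > 0\<close> show ?thesis unfolding m by blast
  qed
  have G: "continuous_on UNIV G"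
    unfolding G_def using \<open>m > 0\<close>
    by (intro continuous_intros continuous_on_cext f' g') auto
  have "(\<lambda>n. ((SUP y. \<bar>f y\<bar> + t n * k n y) - (SUP y. \<bar>f y\<bar>)) / t n)
      \<longlonglongrightarrow> (SUP x\<in>A0 (\<lambda>y. \<bar>f y\<bar>). G x)"
    by (rule tendsto_SUP_difference_quotient[OF compact_metric_completion[OF tb]
        bdd_above_abs_linf G t K close])
  moreover have "(SUP y. \<bar>f y\<bar> + t n * k n y) = norm (f + t n *\<^sub>R hs n)" for n
    using t(1)[of n] by (simp add: k_def norm_linf_def)
  \<comment> \<open>Uniform continuity of \<open>\<bar>f\<bar>\<close> turns \<open>A0\<close> into
    \<open>Mplus\<close>, and there \<open>G\<close> agrees with the product involving the
    sign.\<close>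
  moreover have "(SUP x\<in>Mplus (\<lambda>y. \<bar>f y\<bar>). cext g x * sgn (cext f x))
      = (SUP x\<in>A0 (\<lambda>y. \<bar>f y\<bar>). G x)"
    by (simp add: A0_eq_Mplus[OF abs_f] G_eq cong: SUP_cong_simp)
  ultimately show "(\<lambda>n. (norm (f + t n *\<^sub>R hs n) - norm f) / t n)
      \<longlonglongrightarrow> (SUP x\<in>Mplus (\<lambda>y. \<bar>f y\<bar>). cext g x * sgn (cext f x))"
    by (simp add: m flip: m_def)
qed

theorem corollary2p5:
  fixes f :: "'a::metric_space linf"
  assumes "totally_bounded (UNIV :: 'a set)"
  shows
    "has_hadamard_derivative (\<lambda>h :: 'a linf. SUP x. h x)
       (\<lambda>g. SUP x\<in>A0 f. cext g x) f Cu \<and>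
     has_hadamard_derivative (\<lambda>h :: 'a linf. INF x. h x)
       (\<lambda>g. INF x\<in>B0 f. cext g x) f Cu \<and>
     has_hadamard_derivative (\<lambda>h :: 'a linf. (SUP x. h x) - (INF x. h x))
       (\<lambda>g. (SUP x\<in>A0 f. cext g x) - (INF x\<in>B0 f. cext g x)) f Cu \<and>
     (f \<in> Cu - {0} \<longrightarrow>
       has_hadamard_derivative (\<lambda>h :: 'a linf. norm h)
         (\<lambda>g. SUP x\<in>Mplus (\<lambda>y. \<bar>f y\<bar>). cext g x * sgn (cext f x)) f Cu \<and>
       has_hadamard_derivative (\<lambda>h :: 'a linf. SUP x. h x)
         (\<lambda>g. SUP x\<in>Mplus f. cext g x) f Cu \<and>
       has_hadamard_derivative (\<lambda>h :: 'a linf. INF x. h x)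
         (\<lambda>g. INF x\<in>Mminus f. cext g x) f Cu \<and>
       has_hadamard_derivative (\<lambda>h :: 'a linf. (SUP x. h x) - (INF x. h x))
         (\<lambda>g. (SUP x\<in>Mplus f. cext g x) - (INF x\<in>Mminus f. cext g x)) f Cu)"
proof -
  note sup = has_hadamard_derivative_SUP[OF assms, of f]
  note inf = has_hadamard_derivative_INF[OF assms, of f]
  \<comment> \<open>For uniformly continuous \<open>f\<close> the formulas for supremum, infimum and
    their difference thus become those over level sets; only the norm needs its own
    argument.\<close>
  have "A0 f = Mplus f" "B0 f = Mminus f" if "f \<in> Cu"
    using that by (simp_all add: Cu_def A0_eq_Mplus B0_eq_Mminus)
  then show ?thesis
    using sup inf has_hadamard_derivative_diff[OF sup inf]
      has_hadamard_derivative_norm[OF assms, of f] by auto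
qed

end
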